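(* Let $0\le\nu\le n$ be integers. The complementary polynomial $\mathscr{P}_\nu(x;n)$ satisfies the Sturm–Liouville differential equation $$\frac{d}{dx}\left(\frac{d\mathscr{P}_\nu(x;n)}{dx}\,\mathbf{u}_{n-\nu+1}\right)=-\mu_{n,\nu}\,\mathscr{P}_\nu(x;n)\,\mathbf{u}_{n-\nu}\quad\text{in }\mathbb{P}',$$ which, since $\mathbf{u}$ is regular, is equivalent to $$\phi(x)\frac{d^2\mathscr{P}_\nu(x;n)}{dx^2}+\big[(n-\nu)\phi'(x)+\psi(x)\big]\frac{d\mathscr{P}_\nu(x;n)}{dx}=-\mu_{n,\nu}\,\mathscr{P}_\nu(x;n),$$ and the eigenvalues are given by $$\mu_{n,\nu}=-\nu\Big(\big(n-\tfrac{\nu+1}{2}\big)\phi''+\psi'\Big).$$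
   Context: Let $\mathbb{P}=\mathbb{C}[x]$ and let $\mathbb{P}'$ be its algebraic dual (the linear functionals on $\mathbb{P}$). For $\mathbf{v}\in\mathbb{P}'$ and $Q\in\mathbb{P}$, define $Q\mathbf{v}$ and $\frac{d}{dx}\mathbf{v}=\mathbf{v}'$ in $\mathbb{P}'$ by $\langle Q\mathbf{v},P\rangle=\langle\mathbf{v},QP\rangle$ and $\langle\mathbf{v}',P\rangle=-\langle\mathbf{v},P'\rangle$ for $P\in\mathbb{P}$. Standing assumptions. $\phi,\psi\in\mathbb{P}$ with $\deg\phi\le 2$, $\deg\psi\le 1$ (so $\phi''$ and $\psi'$ are constants). $\mathbf{u}\in\mathbb{P}'$ satisfies $\frac{d}{dx}[\phi\mathbf{u}]=\psi\mathbf{u}$. $\mathbf{u}$ is quasi-definite (regular): there are polynomials $P_n$ with $\deg P_n=n$ ($n\ge 0$) such that $\langle\mathbf{u},P_nP_m\rangle=r_n\delta_{n,m}$ with $r_n\neq 0$. The $P_n$ are solutions of $\phi P_n''+\psi P_n'+\lambda_nP_n=0$ with $\lambda_n=-n\psi'-\frac n2(n-1)\phi''$. Put $\mathbf{u}_0=\mathbf{u}$, $\mathbf{u}_k=\phi\,\mathbf{u}_{k-1}$ for $k\ge1$. The Rodrigues functional formula holds: $P_n\mathbf{u}=B_n\frac{d^n}{dx^n}[\mathbf{u}_n]$ with constants $B_n\neq0$. Rodrigues operator. For a pair $(\phi,\mathbf{v})$ for which there is a polynomial $\chi$ with $\frac{d}{dx}[\phi\mathbf{v}]=\chi\mathbf{v}$,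 put $\mathbf{v}_1=\phi\mathbf{v}$ and define operators on $\mathbb{P}$ by: $R_0(\phi,\mathbf{v})=I$ (the identity); $R_1(\phi,\mathbf{v})[p]=q$ where $q$ is the polynomial with $\frac{d}{dx}[p\,\mathbf{v}_1]=q\,\mathbf{v}$; $R_k(\phi,\mathbf{v})=R_1(\phi,\mathbf{v})\circ R_{k-1}(\phi,\mathbf{v}_1)$ for $k\ge 2$. Complementary polynomials. For integers $0\le\nu\le n$, the complementary polynomial $\mathscr{P}_\nu(x;n)$ with respect to $P_n$ is the polynomial determined by $P_n(x)=B_n\,R_{n-\nu}(\phi,\mathbf{u})[\mathscr{P}_\nu(x;n)]$, where $B_n$ is the constant of the Rodrigues functional formula. *)

theory Defs
  imports Complex_Main "HOL-Computational_Algebra.Polynomial"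
begin

text \<open>Elements of the algebraic dual of the complex polynomials are the maps satisfying
  \<open>in_dual\<close>; the operations below are defined on all maps and preserve \<open>in_dual\<close>.\<close>

type_synonym functional = "complex poly \<Rightarrow> complex"

definition in_dual :: "functional \<Rightarrow> bool" where
  "in_dual v \<longleftrightarrow> Vector_Spaces.linear smult (*) v"

definition fmult :: "complex poly \<Rightarrow> functional \<Rightarrow> functional" (infixr "\<cdot>" 75) where
  "Q \<cdot> v = (\<lambda>p. v (Q * p))"

definition fderiv :: "functional \<Rightarrow> functional" where
  "fderiv v = (\<lambda>p. - v (pderiv p))"

text \<open>Orthogonal polynomial sequences. A functional is quasi-definite (regular) iff it
  possesses such a sequence. (\<open>degree 0 = 0\<close> is harmless: \<open>r 0 \<noteq> 0\<close> forces \<open>P 0 \<noteq> 0\<close>.)\<close>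

definition orthogonal_sequence :: "functional \<Rightarrow> (nat \<Rightarrow> complex poly) \<Rightarrow> bool" where
  "orthogonal_sequence u P \<longleftrightarrow>
     (\<forall>n. degree (P n) = n) \<and>
     (\<exists>r. (\<forall>n. r n \<noteq> 0) \<and> (\<forall>n m. u (P n * P m) = (if n = m then r n else 0)))"

primrec u_seq :: "complex poly \<Rightarrow> functional \<Rightarrow> nat \<Rightarrow> functional" where
  "u_seq \<phi> u 0 = u"
| "u_seq \<phi> u (Suc k) = \<phi> \<cdot> u_seq \<phi> u k"

text \<open>For \<open>degree \<phi> \<le> 2\<close> and \<open>degree \<psi> \<le> 1\<close> the polynomials \<open>\<phi>''\<close> and \<open>\<psi>'\<close> are constant;
  their values are read off as the coefficient of index 0.\<close>

definition lam :: "complex poly \<Rightarrow> complex poly \<Rightarrow> nat \<Rightarrow> complex" where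
  "lam \<phi> \<psi> n =
     - of_nat n * coeff (pderiv \<psi>) 0
     - of_nat n / 2 * (of_nat n - 1) * coeff (pderiv (pderiv \<phi>)) 0"

definition mu :: "complex poly \<Rightarrow> complex poly \<Rightarrow> nat \<Rightarrow> nat \<Rightarrow> complex" where
  "mu \<phi> \<psi> n \<nu> =
     - of_nat \<nu> * ((of_nat n - (of_nat \<nu> + 1) / 2) * coeff (pderiv (pderiv \<phi>)) 0
                   + coeff (pderiv \<psi>) 0)"

definition rodrigues_op1 :: "complex poly \<Rightarrow> functional \<Rightarrow> complex poly \<Rightarrow> complex poly" where
  "rodrigues_op1 \<phi> v p = (THE q. fderiv (p \<cdot> (\<phi> \<cdot> v)) = q \<cdot> v)"

text \<open>The instance \<open>k = 0\<close> of the second equation gives \<open>rodrigues_op1\<close>.\<close>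

primrec rodrigues_op ::
  "nat \<Rightarrow> complex poly \<Rightarrow> functional \<Rightarrow> complex poly \<Rightarrow> complex poly" where
  "rodrigues_op 0 \<phi> v = id"
| "rodrigues_op (Suc k) \<phi> v = rodrigues_op1 \<phi> v \<circ> rodrigues_op k \<phi> (\<phi> \<cdot> v)"

text \<open>The complementary polynomial of index \<open>\<nu>\<close> with respect to \<open>P n\<close>, where \<open>B n\<close> is the
  constant of the Rodrigues formula for \<open>P n\<close>.\<close>

definition complementary ::
  "complex poly \<Rightarrow> functional \<Rightarrow> (nat \<Rightarrow> complex poly) \<Rightarrow> (nat \<Rightarrow> complex) \<Rightarrow> nat \<Rightarrow> nat
     \<Rightarrow> complex poly" where
  "complementary \<phi> u P B n \<nu> =
     (THE p. P n = smult (B n) (rodrigues_op (n - \<nu>) \<phi> u p))"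

end

theory Submission
  imports Defs
begin

text \<open>
  A Pearson equation \<open>(\<phi> v)' = \<psi> v\<close> turns the Leibniz rule into
  \<open>(p \<phi> v)' = (\<phi> p' + \<psi> p) v\<close>, so as long as \<open>v\<close> is annihilated by no nonzero polynomial,
  the Rodrigues operator \<open>R\<^sub>1\<close> is the differential operator \<open>S\<^sub>\<psi> p = \<phi> p' + \<psi> p\<close>.  Passing from
  \<open>v\<close> to \<open>\<phi> v\<close> replaces \<open>\<psi>\<close> by \<open>\<phi>' + \<psi>\<close>, hence \<open>R\<^sub>k\<close> at \<open>u\<close> is the product
  \<open>S\<^sub>0 S\<^sub>1 \<dots> S\<^sub>k\<^sub>-\<^sub>1\<close>, where \<open>S\<^sub>j\<close> belongs to \<open>\<psi>\<^sub>j = j \<phi>' + \<psi>\<close>.  Iterating the Leibniz rule in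
  the functional Rodrigues formula gives \<open>P\<^sub>n = B\<^sub>n S\<^sub>0 \<dots> S\<^sub>n\<^sub>-\<^sub>1 1\<close>.  Every \<open>S\<^sub>j\<close> is
  injective, because differentiation of functionals is and \<open>\<phi>\<^sup>j\<^sup>+\<^sup>1 u\<close> is annihilated by no
  nonzero polynomial, so the complementary polynomial is the right-hand part of this product,
  \<open>S\<^sub>k S\<^sub>k\<^sub>+\<^sub>1 \<dots> S\<^sub>n\<^sub>-\<^sub>1 1\<close> with \<open>k = n - \<nu>\<close>.

  The Sturm--Liouville operator is \<open>L\<^sub>k y = \<phi> y'' + \<psi>\<^sub>k y' = S\<^sub>k (y')\<close>.  Differentiating
  \<open>S\<^sub>k p\<close> gives \<open>S\<^sub>k\<^sub>+\<^sub>1 (p') + \<psi>\<^sub>k' p\<close>, and therefore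
  \<open>L\<^sub>k S\<^sub>k = S\<^sub>k (L\<^sub>k\<^sub>+\<^sub>1 + \<psi>\<^sub>k')\<close> with the constant
  \<open>\<psi>\<^sub>k' = k \<phi>'' + \<psi>'\<close>.  So each factor \<open>S\<^sub>j\<close> carries eigenpolynomials of \<open>L\<^sub>j\<^sub>+\<^sub>1\<close> to
  eigenpolynomials of \<open>L\<^sub>j\<close> and adds \<open>j \<phi>'' + \<psi>'\<close> to the eigenvalue.  Starting from \<open>1\<close>, which
  has eigenvalue \<open>0\<close>, the sum over \<open>n - \<nu> \<le> j < n\<close> is \<open>-\<mu>\<close>.  The two forms of
  the differential equation agree because \<open>u\<close>, and with it each \<open>\<phi>\<^sup>k u\<close>, is annihilated by no
  nonzero polynomial.
\<close>

section \<open>Linear functionals and their annihilators\<close>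

lemma in_dual_add: "in_dual v \<Longrightarrow> v (p + q) = v p + v q"
  and in_dual_smult: "in_dual v \<Longrightarrow> v (smult c p) = c * v p"
  and in_dual_diff: "in_dual v \<Longrightarrow> v (p - q) = v p - v q"
  and in_dual_zero: "in_dual v \<Longrightarrow> v 0 = 0"
proof -
  assume v: "in_dual v"
  interpret Vector_Spaces.linear smult "(*)" v
    using v by (simp add: in_dual_def)
  show "v (p + q) = v p + v q" by (rule add)
  show "v (smult c p) = c * v p" by (rule scale)
  show "v (p - q) = v p - v q" by (rule diff)
  show "v 0 = 0" by (rule zero)
qed

lemma in_dual_fmult: "in_dual v \<Longrightarrow> in_dual (q \<cdot> v)"
  unfolding in_dual_def Vector_Spaces.linear_iff fmult_def
  by (simp add: distrib_left)

definition faithful :: "functional \<Rightarrow> bool" where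
  "faithful v \<longleftrightarrow> (\<forall>q. q \<cdot> v = (\<lambda>_. 0) \<longrightarrow> q = 0)"

lemma faithful_cancel:
  assumes "in_dual v" "faithful v"
  shows "p \<cdot> v = q \<cdot> v \<longleftrightarrow> p = q"
proof
  assume eq: "p \<cdot> v = q \<cdot> v"
  have "(p - q) \<cdot> v = (\<lambda>_. 0)"
    using fun_cong[OF eq] assms(1)
    by (auto simp: fmult_def left_diff_distrib in_dual_diff)
  then show "p = q" using assms(2) by (auto simp: faithful_def)
qed simp

lemma faithful_fmult:
  assumes "faithful v" "\<phi> \<noteq> 0"
  shows "faithful (\<phi> \<cdot> v)"
  unfolding faithful_def
proof (intro allI impI)
  fix q assume "q \<cdot> (\<phi> \<cdot> v) = (\<lambda>_. 0)"
  then have "(\<phi> * q) \<cdot> v = (\<lambda>_. 0)" by (simp add: fmult_def mult.assoc)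
  then show "q = 0" using assms by (auto simp: faithful_def)
qed

lemma in_dual_u_seq: "in_dual v \<Longrightarrow> in_dual (u_seq \<phi> v k)"
  by (induction k) (auto intro: in_dual_fmult)

lemma faithful_u_seq: "faithful v \<Longrightarrow> \<phi> \<noteq> 0 \<Longrightarrow> faithful (u_seq \<phi> v k)"
  by (induction k) (auto intro: faithful_fmult)

text \<open>Rodrigues operators recurse by replacing the base functional \<open>v\<close> by \<open>\<phi> \<cdot> v\<close>, so inductions
  over them need \<open>u_seq\<close> unfolded at its base instead of its outermost factor.\<close>

lemma u_seq_shift: "u_seq \<phi> v (Suc k) = u_seq \<phi> (\<phi> \<cdot> v) k"
  by (induction k) auto

lemma orthogonal_lower_degree:
  assumes "in_dual u" "orthogonal_sequence u P"
    and "\<And>i. i \<ge> d \<Longrightarrow> coeff q i = 0" "d \<le> n"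
  shows "u (q * P n) = 0"
  using assms(3,4)
proof (induction d arbitrary: q)
  case 0
  then have "q = 0" by (simp add: poly_eq_iff)
  then show ?case using assms(1) by (simp add: in_dual_zero)
next
  case (Suc d)
  from assms(2) obtain r where deg: "\<And>n. degree (P n) = n" and r: "\<And>n. r n \<noteq> 0"
    and orth: "\<And>n m. u (P n * P m) = (if n = m then r n else 0)"
    unfolding orthogonal_sequence_def by blast
  have "P d \<noteq> 0" using orth[of d d] r[of d] assms(1) by (auto simp: in_dual_zero)
  then have lead: "coeff (P d) d \<noteq> 0" using deg[of d] leading_coeff_0_iff[of "P d"] by simp
  define c where "c = coeff q d / coeff (P d) d"
  have "coeff (q - smult c (P d)) i = 0" if "i \<ge> d" for i
    using that lead Suc.prems(1)[of i] deg[of d]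
    by (cases "i = d") (auto simp: c_def coeff_eq_0)
  then have "u ((q - smult c (P d)) * P n) = 0" using Suc by simp
  then show ?case using Suc.prems(2) orth[of d n] assms(1)
    by (simp add: left_diff_distrib in_dual_diff in_dual_smult)
qed

text \<open>A nonzero \<open>q\<close> of degree \<open>m\<close> is detected by \<open>P m\<close>: up to lower-degree terms, which are
  orthogonal to \<open>P m\<close>, it is a nonzero multiple of \<open>P m\<close>.\<close>

lemma orthogonal_imp_faithful:
  assumes "in_dual u" "orthogonal_sequence u P"
  shows "faithful u"
  unfolding faithful_def
proof (intro allI impI)
  fix q assume ann: "q \<cdot> u = (\<lambda>_. 0)"
  from assms(2) obtain r where deg: "\<And>n. degree (P n) = n" and r: "\<And>n. r n \<noteq> 0"
    and orth: "\<And>n m. u (P n * P m) = (if n = m then r n else 0)"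
    unfolding orthogonal_sequence_def by blast
  define m where "m = degree q"
  have "P m \<noteq> 0" using orth[of m m] r[of m] assms(1) by (auto simp: in_dual_zero)
  then have lead: "coeff (P m) m \<noteq> 0" using deg[of m] leading_coeff_0_iff[of "P m"] by simp
  define c where "c = coeff q m / coeff (P m) m"
  have "coeff (q - smult c (P m)) i = 0" if "i \<ge> m" for i
    using that lead deg[of m] m_def
    by (cases "i = m") (auto simp: c_def coeff_eq_0)
  then have "u ((q - smult c (P m)) * P m) = 0"
    using orthogonal_lower_degree[OF assms] by blast
  moreover have "u (q * P m) = 0" using fun_cong[OF ann, of "P m"] by (simp add: fmult_def)
  ultimately have "c * r m = 0"
    using orth[of m m] assms(1) by (simp add: left_diff_distrib in_dual_diff in_dual_smult)
  then have "coeff q m = 0" using r lead by (simp add: c_def)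
  then show "q = 0" by (simp add: m_def)
qed

section \<open>Derivatives of functionals\<close>

text \<open>Since every polynomial has an antiderivative, a functional with vanishing derivative
  vanishes: there are no nonzero constants of integration in the dual.\<close>

lemma surj_pderiv: "surj (pderiv :: 'a :: field_char_0 poly \<Rightarrow> 'a poly)"
proof (rule surjI)
  fix p :: "'a poly"
  show "pderiv (\<Sum>i\<le>degree p. monom (coeff p i / of_nat (Suc i)) (Suc i)) = p"
    by (simp add: higher_pderiv_sum[of 1, simplified] pderiv_monom poly_as_sum_of_monoms
        del: of_nat_Suc)
qed

lemma fderiv_eq_0_imp:
  assumes "fderiv v = (\<lambda>_. 0)"
  shows "v = (\<lambda>_. 0)"
proof
  fix p :: "complex poly"
  obtain q where "p = pderiv q" using surj_pderiv by (meson surjD)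
  then show "v p = 0" using fun_cong[OF assms, of q] by (simp add: fderiv_def)
qed

lemma fderiv_fmult:
  assumes "in_dual v"
  shows "fderiv (p \<cdot> v) f = (p \<cdot> fderiv v) f + (pderiv p \<cdot> v) f"
  using assms
  by (simp add: fderiv_def fmult_def pderiv_mult in_dual_add mult.commute)

section \<open>The differential operator of a Pearson equation\<close>

definition pearson_op :: "'a::idom poly \<Rightarrow> 'a poly \<Rightarrow> 'a poly \<Rightarrow> 'a poly" where
  "pearson_op \<phi> \<psi> p = \<phi> * pderiv p + \<psi> * p"

lemma pearson_op_add: "pearson_op \<phi> \<psi> (p + q) = pearson_op \<phi> \<psi> p + pearson_op \<phi> \<psi> q"
  by (simp add: pearson_op_def pderiv_add algebra_simps)

lemma pearson_op_smult: "pearson_op \<phi> \<psi> (smult c p) = smult c (pearson_op \<phi> \<psi> p)"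
  by (simp add: pearson_op_def pderiv_smult smult_add_right)

lemma fderiv_pearson:
  assumes "in_dual v" "fderiv (\<phi> \<cdot> v) = \<psi> \<cdot> v"
  shows "fderiv (p \<cdot> (\<phi> \<cdot> v)) = pearson_op \<phi> \<psi> p \<cdot> v"
proof
  fix f
  show "fderiv (p \<cdot> (\<phi> \<cdot> v)) f = (pearson_op \<phi> \<psi> p \<cdot> v) f"
    unfolding fderiv_fmult[OF in_dual_fmult[OF assms(1)]] assms(2)
    using assms(1) by (simp add: pearson_op_def fmult_def in_dual_add algebra_simps)
qed

lemma pearson_fmult:
  assumes "in_dual v" "fderiv (\<phi> \<cdot> v) = \<psi> \<cdot> v"
  shows "fderiv (\<phi> \<cdot> (\<phi> \<cdot> v)) = (pderiv \<phi> + \<psi>) \<cdot> (\<phi> \<cdot> v)"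
  unfolding fderiv_pearson[OF assms]
  by (simp add: pearson_op_def fmult_def algebra_simps)

lemma pearson_u_seq:
  assumes "in_dual v" "fderiv (\<phi> \<cdot> v) = \<psi> \<cdot> v"
  shows "fderiv (\<phi> \<cdot> u_seq \<phi> v k) = (of_nat k * pderiv \<phi> + \<psi>) \<cdot> u_seq \<phi> v k"
proof (induction k)
  case 0
  then show ?case using assms by simp
next
  case (Suc k)
  from pearson_fmult[OF in_dual_u_seq[OF assms(1)] Suc.IH]
  show ?case by (simp add: algebra_simps)
qed

text \<open>A functional that satisfies the Pearson equation is a witness for a statement about
  polynomials alone: \<open>pearson_op \<phi> \<psi> p = 0\<close> makes the derivative of \<open>p \<cdot> (\<phi> \<cdot> v)\<close> vanish,
  hence \<open>p \<cdot> (\<phi> \<cdot> v)\<close> itself.\<close>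

lemma pearson_op_inj:
  assumes "in_dual v" "faithful v" "\<phi> \<noteq> 0" "fderiv (\<phi> \<cdot> v) = \<psi> \<cdot> v"
  shows "inj (pearson_op \<phi> \<psi>)"
proof (rule injI)
  fix p q assume eq: "pearson_op \<phi> \<psi> p = pearson_op \<phi> \<psi> q"
  have "pearson_op \<phi> \<psi> (p - q) = 0"
    using eq by (simp add: pearson_op_def pderiv_diff algebra_simps)
  then have "fderiv ((p - q) \<cdot> (\<phi> \<cdot> v)) = (\<lambda>_. 0)"
    unfolding fderiv_pearson[OF assms(1,4)] using assms(1)
    by (simp add: fmult_def in_dual_zero)
  then have "(p - q) \<cdot> (\<phi> \<cdot> v) = (\<lambda>_. 0)" by (rule fderiv_eq_0_imp)
  then show "p = q" using faithful_fmult[OF assms(2,3)] by (auto simp: faithful_def)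
qed

lemma rodrigues_op1_eq:
  assumes "in_dual v" "faithful v" "fderiv (\<phi> \<cdot> v) = \<psi> \<cdot> v"
  shows "rodrigues_op1 \<phi> v = pearson_op \<phi> \<psi>"
  unfolding rodrigues_op1_def fderiv_pearson[OF assms(1,3)] faithful_cancel[OF assms(1,2)]
  by auto

section \<open>Iterated Rodrigues operators\<close>

primrec pearson_iter :: "nat \<Rightarrow> 'a::idom poly \<Rightarrow> 'a poly \<Rightarrow> 'a poly \<Rightarrow> 'a poly" where
  "pearson_iter 0 \<phi> \<psi> = id"
| "pearson_iter (Suc k) \<phi> \<psi> = pearson_op \<phi> \<psi> \<circ> pearson_iter k \<phi> (pderiv \<phi> + \<psi>)"

lemma pearson_iter_add:
  "pearson_iter (m + k) \<phi> \<psi>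
     = pearson_iter m \<phi> \<psi> \<circ> pearson_iter k \<phi> (of_nat m * pderiv \<phi> + \<psi>)"
  by (induction m arbitrary: \<psi>) (auto simp: comp_assoc algebra_simps)

lemma rodrigues_op_eq:
  assumes "in_dual v" "faithful v" "\<phi> \<noteq> 0" "fderiv (\<phi> \<cdot> v) = \<psi> \<cdot> v"
  shows "rodrigues_op k \<phi> v = pearson_iter k \<phi> \<psi>"
  using assms
proof (induction k arbitrary: v \<psi>)
  case (Suc k)
  have "rodrigues_op k \<phi> (\<phi> \<cdot> v) = pearson_iter k \<phi> (pderiv \<phi> + \<psi>)"
    using Suc.prems by (intro Suc.IH in_dual_fmult faithful_fmult pearson_fmult) auto
  then show ?case using rodrigues_op1_eq[OF Suc.prems(1,2,4)] by simp
qed simp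

lemma pearson_iter_inj:
  assumes "in_dual v" "faithful v" "\<phi> \<noteq> 0" "fderiv (\<phi> \<cdot> v) = \<psi> \<cdot> v"
  shows "inj (pearson_iter k \<phi> \<psi>)"
  using assms
proof (induction k arbitrary: v \<psi>)
  case (Suc k)
  have "inj (pearson_iter k \<phi> (pderiv \<phi> + \<psi>))"
    using Suc.prems by (intro Suc.IH[of "\<phi> \<cdot> v"] in_dual_fmult faithful_fmult pearson_fmult) auto
  then show ?case unfolding pearson_iter.simps by (rule inj_compose[OF pearson_op_inj[OF Suc.prems]])
qed simp

lemma fderiv_iter:
  assumes "in_dual v" "fderiv (\<phi> \<cdot> v) = \<psi> \<cdot> v"
  shows "(fderiv ^^ k) (p \<cdot> u_seq \<phi> v k) = pearson_iter k \<phi> \<psi> p \<cdot> v"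
  using assms
proof (induction k arbitrary: v \<psi>)
  case (Suc k)
  have "(fderiv ^^ k) (p \<cdot> u_seq \<phi> (\<phi> \<cdot> v) k)
          = pearson_iter k \<phi> (pderiv \<phi> + \<psi>) p \<cdot> (\<phi> \<cdot> v)"
    using Suc.prems by (intro Suc.IH in_dual_fmult pearson_fmult)
  then show ?case
    unfolding u_seq_shift by (simp add: fderiv_pearson[OF Suc.prems])
qed simp

text \<open>Applying \<open>pearson_op \<phi> \<psi>\<close> to both sides yields the intertwining relation
  \<open>L\<^sub>k S\<^sub>k = S\<^sub>k (L\<^sub>k\<^sub>+\<^sub>1 + \<psi>\<^sub>k')\<close>, because \<open>L\<^sub>k y = S\<^sub>k (y')\<close>.\<close>

lemma pderiv_pearson_op:
  "pderiv (pearson_op \<phi> \<psi> p) = pearson_op \<phi> (pderiv \<phi> + \<psi>) (pderiv p) + pderiv \<psi> * p"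
  by (simp add: pearson_op_def pderiv_add pderiv_mult algebra_simps)

text \<open>Each factor adds the constant derivative of its own \<open>\<psi>\<close> to the eigenvalue.  These
  constants form the arithmetic progression \<open>b, b + a, \<dots>, b + (m - 1) a\<close>, whose sum is the
  eigenvalue.\<close>

lemma pearson_iter_eigen:
  fixes a b :: "'a :: field_char_0"
  assumes "pderiv (pderiv \<phi>) = [:a:]" "pderiv \<psi> = [:b:]"
  shows "pearson_op \<phi> \<psi> (pderiv (pearson_iter m \<phi> \<psi> 1))
           = smult (of_nat m * b + of_nat m * (of_nat m - 1) / 2 * a) (pearson_iter m \<phi> \<psi> 1)"
  using assms(2)
proof (induction m arbitrary: \<psi> b)
  case 0
  then show ?case by (simp add: pearson_op_def)
next
  case (Suc m)
  define y where "y = pearson_iter m \<phi> (pderiv \<phi> + \<psi>) 1"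
  define e where "e = of_nat m * (a + b) + of_nat m * (of_nat m - 1) / 2 * a"
  have IH: "pearson_op \<phi> (pderiv \<phi> + \<psi>) (pderiv y) = smult e y"
    unfolding y_def e_def using assms(1) Suc.prems by (intro Suc.IH) (simp add: pderiv_add)
  have "pearson_op \<phi> \<psi> (pderiv (pearson_op \<phi> \<psi> y)) = smult (e + b) (pearson_op \<phi> \<psi> y)"
    unfolding pderiv_pearson_op IH
    by (simp add: Suc.prems pearson_op_add pearson_op_smult smult_add_left)
  moreover have "e + b = of_nat (Suc m) * b + of_nat (Suc m) * (of_nat (Suc m) - 1) / 2 * a"
    by (simp add: e_def field_simps)
  ultimately show ?case by (simp add: y_def)
qed

section \<open>Complementary polynomials\<close>

text \<open>If \<open>\<phi>\<close> vanished, the Rodrigues formula would make \<open>P 1\<close> annihilate \<open>u\<close>.\<close>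

lemma rodrigues_phi_nonzero:
  assumes "in_dual u" "orthogonal_sequence u P"
    and "\<And>k. P k \<cdot> u = (\<lambda>p. B k * (fderiv ^^ k) (u_seq \<phi> u k) p)"
  shows "\<phi> \<noteq> 0"
proof
  assume "\<phi> = 0"
  then have "P 1 \<cdot> u = (\<lambda>_. 0)"
    using assms(1) assms(3)[of 1] by (simp add: fderiv_def fmult_def in_dual_zero)
  then have "P 1 = 0"
    using orthogonal_imp_faithful[OF assms(1,2)] by (auto simp: faithful_def)
  then show False
    using assms(2) degree_0 by (metis orthogonal_sequence_def zero_neq_one)
qed

lemma rodrigues_formula:
  assumes "in_dual u" "faithful u" "fderiv (\<phi> \<cdot> u) = \<psi> \<cdot> u"
    and "p \<cdot> u = (\<lambda>f. c * (fderiv ^^ n) (u_seq \<phi> u n) f)"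
  shows "p = smult c (pearson_iter n \<phi> \<psi> 1)"
proof -
  have "p \<cdot> u = smult c (pearson_iter n \<phi> \<psi> 1) \<cdot> u"
    using fderiv_iter[OF assms(1,3), of n 1] assms(1,4)
    by (simp add: fmult_def in_dual_smult)
  then show ?thesis using faithful_cancel[OF assms(1,2)] by simp
qed

text \<open>The Rodrigues formula writes \<open>P n\<close> as the full product of operators applied to \<open>1\<close>;
  splitting off the first \<open>n - \<nu>\<close> of them exhibits a preimage under \<open>rodrigues_op (n - \<nu>)\<close>, and
  injectivity makes it the only one.\<close>

lemma complementary_eq:
  assumes "in_dual u" "faithful u" "\<phi> \<noteq> 0" "fderiv (\<phi> \<cdot> u) = \<psi> \<cdot> u"
    and "P n \<cdot> u = (\<lambda>p. B n * (fderiv ^^ n) (u_seq \<phi> u n) p)"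
    and "B n \<noteq> 0" "\<nu> \<le> n"
  shows "complementary \<phi> u P B n \<nu> = pearson_iter \<nu> \<phi> (of_nat (n - \<nu>) * pderiv \<phi> + \<psi>) 1"
    (is "_ = ?y")
proof -
  have "pearson_iter n \<phi> \<psi> 1 = pearson_iter (n - \<nu>) \<phi> \<psi> ?y"
    using pearson_iter_add[of "n - \<nu>" \<nu> \<phi> \<psi>] assms(7) by simp
  then have "P n = smult (B n) (pearson_iter (n - \<nu>) \<phi> \<psi> ?y)"
    using rodrigues_formula[OF assms(1,2,4,5)] by simp
  then show ?thesis
    unfolding complementary_def rodrigues_op_eq[OF assms(1-4)]
    using pearson_iter_inj[OF assms(1-4)] assms(6)
    by (intro the_equality) (auto simp: smult_eq_iff inj_eq)
qed

lemma pderiv_constant: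
  fixes p :: "'a :: {comm_semiring_1,semiring_no_zero_divisors,semiring_char_0} poly"
  assumes "degree p \<le> 1"
  shows "pderiv p = [:coeff (pderiv p) 0:]"
  using assms by (intro degree_0_id[symmetric]) (simp add: degree_pderiv)

theorem theorem5p1:
  fixes \<phi> \<psi> :: "complex poly" and u :: functional
    and P :: "nat \<Rightarrow> complex poly" and B :: "nat \<Rightarrow> complex" and n \<nu> :: nat
  assumes "degree \<phi> \<le> 2" and "degree \<psi> \<le> 1"
    and "in_dual u"
    and "fderiv (\<phi> \<cdot> u) = \<psi> \<cdot> u"
    and "orthogonal_sequence u P"
    and "\<And>k. \<phi> * pderiv (pderiv (P k)) + \<psi> * pderiv (P k) + smult (lam \<phi> \<psi> k) (P k) = 0"
    and "\<And>k. B k \<noteq> 0"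
    and "\<And>k. P k \<cdot> u = (\<lambda>p. B k * (fderiv ^^ k) (u_seq \<phi> u k) p)"
    and "\<nu> \<le> n"
  shows "fderiv (pderiv (complementary \<phi> u P B n \<nu>) \<cdot> u_seq \<phi> u (n - \<nu> + 1))
           = smult (- mu \<phi> \<psi> n \<nu>) (complementary \<phi> u P B n \<nu>) \<cdot> u_seq \<phi> u (n - \<nu>)
       \<and> (\<forall>y c. fderiv (pderiv y \<cdot> u_seq \<phi> u (n - \<nu> + 1)) = smult (- c) y \<cdot> u_seq \<phi> u (n - \<nu>)
            \<longleftrightarrow> \<phi> * pderiv (pderiv y) + (of_nat (n - \<nu>) * pderiv \<phi> + \<psi>) * pderiv y
                  = smult (- c) y)
       \<and> \<phi> * pderiv (pderiv (complementary \<phi> u P B n \<nu>))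
           + (of_nat (n - \<nu>) * pderiv \<phi> + \<psi>) * pderiv (complementary \<phi> u P B n \<nu>)
           = smult (- mu \<phi> \<psi> n \<nu>) (complementary \<phi> u P B n \<nu>)"
proof -
  define k where "k = n - \<nu>"
  define \<chi> where "\<chi> = of_nat k * pderiv \<phi> + \<psi>"
  define a where "a = coeff (pderiv (pderiv \<phi>)) 0"
  define b where "b = coeff (pderiv \<psi>) 0"
  define Y where "Y = complementary \<phi> u P B n \<nu>"
  have faithful: "faithful u" by (rule orthogonal_imp_faithful[OF assms(3,5)])
  have \<phi>: "\<phi> \<noteq> 0" by (rule rodrigues_phi_nonzero[OF assms(3,5,8)])
  have a: "pderiv (pderiv \<phi>) = [:a:]"
    unfolding a_def using assms(1) by (intro pderiv_constant) (simp add: degree_pderiv)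
  have "pderiv \<psi> = [:b:]" unfolding b_def by (rule pderiv_constant[OF assms(2)])
  then have \<chi>: "pderiv \<chi> = [:of_nat k * a + b:]"
    by (simp add: \<chi>_def pderiv_add pderiv_mult pderiv_smult a of_nat_poly)

  have "Y = pearson_iter \<nu> \<phi> \<chi> 1"
    unfolding Y_def \<chi>_def k_def
    using assms(3) faithful \<phi> assms(4,8,7,9) by (rule complementary_eq)
  then have "pearson_op \<phi> \<chi> (pderiv Y)
      = smult (of_nat \<nu> * (of_nat k * a + b) + of_nat \<nu> * (of_nat \<nu> - 1) / 2 * a) Y"
    using pearson_iter_eigen[OF a \<chi>] by simp
  also have "of_nat \<nu> * (of_nat k * a + b) + of_nat \<nu> * (of_nat \<nu> - 1) / 2 * a = - mu \<phi> \<psi> n \<nu>"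
    using assms(9) by (simp add: mu_def a_def[symmetric] b_def[symmetric] k_def field_simps)
  finally have eigen: "\<phi> * pderiv (pderiv Y) + \<chi> * pderiv Y = smult (- mu \<phi> \<psi> n \<nu>) Y"
    by (simp add: pearson_op_def)

  have equiv: "fderiv (pderiv y \<cdot> u_seq \<phi> u (k + 1)) = smult (- c) y \<cdot> u_seq \<phi> u k
      \<longleftrightarrow> \<phi> * pderiv (pderiv y) + \<chi> * pderiv y = smult (- c) y" for y c
  proof -
    note dual = in_dual_u_seq[OF assms(3), of \<phi> k]
    have "fderiv (pderiv y \<cdot> u_seq \<phi> u (k + 1)) = pearson_op \<phi> \<chi> (pderiv y) \<cdot> u_seq \<phi> u k"
      using fderiv_pearson[OF dual pearson_u_seq[OF assms(3,4)]] by (simp add: \<chi>_def)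
    then show ?thesis
      using faithful_cancel[OF dual faithful_u_seq[OF faithful \<phi>]]
      by (simp add: pearson_op_def)
  qed
  show ?thesis
    using eigen equiv unfolding Y_def \<chi>_def k_def by blast
qed

end
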